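(* Each of the following graph classes is stable by utter graphs: the split graphs, the trivially perfect graphs, the interval graphs, the chordal graphs, and, for each integer $k\ge 3$, the $k$-hole-free graphs. However, the class of perfect graphs is not stable by utter graphs.
   Context: Graphs are finite and simple. A graph class $\mathcal{C}$ is stable by utter graphs if for every connected graph $G$: $G\in\mathcal{C}$ if and only if $u(G)\in\mathcal{C}$. The utter graph $u(G)$ of a graph $G=(V,E)$ has vertex set $V\cup E$ (disjoint union), and two distinct vertices of $u(G)$ are adjacent if and only if the corresponding elements of $G$ are adjacent, incident, or adjacent by contraction. Explicitly: two vertices of $V$ are adjacent in $u(G)$ iff they are adjacent in $G$; a vertex $w\in V$ and an edge $xy\in E$ are adjacent in $u(G)$ iff $w\in\{x,y\}$ or $w$ is adjacent in $G$ to $x$ or $y$; two distinct edges $xy,zt\in E$ are adjacent in $u(G)$ iff they share an endpoint or some edge of $G$ joins a vertex of $\{x,y\}$ to a vertex of $\{z,t\}$. A split graph is a graph whose vertex set can be partitioned into a stable set and a clique. Given a total order on a finite set, an interval is a (nonempty) subset of consecutive elements; an interval graph is a graph having one vertex per interval of some finite family of intervals, with two vertices adjacent iff their intervals intersect. A family of intervals is nested if any two of its intervals are either disjoint or one is contained in the other; a trivially perfect graph is an interval graph built from a nested family of intervals (equivalently, a graph with no induced cycle on $4$ vertices and no induced path on $4$ vertices). A hole is an induced cycle with at least $4$ vertices; for $k\ge3$, a graph is $k$-hole-free if all its holes have at most $k$ vertices; chordal graphs are the $3$-hole-free graphs. A graph $G$ is perfect if $\omega(H)=\chi(H)$ for every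 induced subgraph $H$ of $G$. *)

theory Defs
  imports "Graph_Theory.Graph_Theory"
begin

text \<open>
  A finite simple graph is a \<^typ>\<open>'a pair_pre_digraph\<close> satisfying \<^const>\<open>pair_graph\<close>: an
  undirected edge \<open>xy\<close> is the pair of opposite arcs \<open>(x, y)\<close> and \<open>(y, x)\<close>. As elements of the
  utter graph, however, edges have to be counted once, hence the two-element sets below.
\<close>

definition uedges :: "'a pair_pre_digraph \<Rightarrow> 'a set set" where
  "uedges G = {{x, y} | x y. (x, y) \<in> parcs G}"

fun utter_adj :: "'a pair_pre_digraph \<Rightarrow> 'a + 'a set \<Rightarrow> 'a + 'a set \<Rightarrow> bool" where
  "utter_adj G (Inl v) (Inl w) \<longleftrightarrow> (v, w) \<in> parcs G"
| "utter_adj G (Inl w) (Inr e) \<longleftrightarrow> w \<in> e \<or> (\<exists>x\<in>e. (w, x) \<in> parcs G)"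
| "utter_adj G (Inr e) (Inl w) \<longleftrightarrow> w \<in> e \<or> (\<exists>x\<in>e. (w, x) \<in> parcs G)"
| "utter_adj G (Inr e) (Inr f) \<longleftrightarrow>
     e \<noteq> f \<and> (e \<inter> f \<noteq> {} \<or> (\<exists>x\<in>e. \<exists>z\<in>f. (x, z) \<in> parcs G))"

definition utter :: "'a pair_pre_digraph \<Rightarrow> ('a + 'a set) pair_pre_digraph" where
  "utter G = (let V = pverts G <+> uedges G
              in \<lparr> pverts = V, parcs = {(a, b). a \<in> V \<and> b \<in> V \<and> utter_adj G a b} \<rparr>)"

lemma utter_adj_sym:
  assumes "pair_graph G" "utter_adj G a b"
  shows "utter_adj G b a"
proof -
  interpret pair_graph G by fact
  have "\<And>x y. (x, y) \<in> parcs G \<Longrightarrow> (y, x) \<in> parcs G"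
    using pair_sym_arcs by (auto simp: symmetric_def dest: symD)
  then show ?thesis
    using assms(2) by (cases a; cases b) auto
qed

lemma pair_graph_utter:
  assumes "pair_graph G"
  shows "pair_graph (utter G)"
proof -
  interpret pair_graph G by fact
  have "uedges G = (\<lambda>(x, y). {x, y}) ` parcs G"
    by (auto simp: uedges_def)
  then have fin: "finite (pverts G <+> uedges G)"
    using pair_finite_verts pair_finite_arcs by simp
  have sub: "parcs (utter G) \<subseteq> (pverts G <+> uedges G) \<times> (pverts G <+> uedges G)"
    by (auto simp: utter_def Let_def)
  have irrefl: "\<not> utter_adj G a a" for a
    using no_loops' by (cases a) auto
  show ?thesis
  proof unfold_locales
    show "finite (pverts (utter G))"
      using fin by (simp add: utter_def Let_def)
    show "finite (parcs (utter G))"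
      using sub fin by (meson finite_SigmaI finite_subset)
    show "symmetric (with_proj (utter G))"
      using utter_adj_sym[OF assms] by (auto simp: symmetric_def utter_def Let_def intro!: symI)
  qed (use irrefl no_loops' in \<open>auto simp: utter_def Let_def\<close>)
qed

text \<open>
  A graph class is given by a type-polymorphic predicate on graphs. Since \<open>G\<close> and \<open>utter G\<close> have
  different vertex types, the notion of stability takes the instances of this predicate at the two
  types as separate arguments; it is only meant to be used with two instances of the same
  polymorphic constant. Over an infinite type such as \<^typ>\<open>nat\<close> the graphs \<open>G\<close> comprise a copy of
  every finite graph, which makes it the right instance for stating that a class is not stable.
\<close>

definition stable_by_utter ::
  "('a pair_pre_digraph \<Rightarrow> bool) \<Rightarrow> (('a + 'a set) pair_pre_digraph \<Rightarrow> bool) \<Rightarrow> bool" where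
  "stable_by_utter C C' \<longleftrightarrow>
     (\<forall>G. pair_graph G \<and> Digraph_Component.connected (with_proj G) \<longrightarrow> (C G \<longleftrightarrow> C' (utter G)))"

definition stable_set :: "'a pair_pre_digraph \<Rightarrow> 'a set \<Rightarrow> bool" where
  "stable_set G S \<longleftrightarrow> S \<subseteq> pverts G \<and> (\<forall>u\<in>S. \<forall>v\<in>S. (u, v) \<notin> parcs G)"

definition clique :: "'a pair_pre_digraph \<Rightarrow> 'a set \<Rightarrow> bool" where
  "clique G K \<longleftrightarrow> K \<subseteq> pverts G \<and> (\<forall>u\<in>K. \<forall>v\<in>K. u \<noteq> v \<longrightarrow> (u, v) \<in> parcs G)"

definition split_graph :: "'a pair_pre_digraph \<Rightarrow> bool" where
  "split_graph G \<longleftrightarrow>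
     (\<exists>S K. S \<union> K = pverts G \<and> S \<inter> K = {} \<and> stable_set G S \<and> clique G K)"

definition is_interval :: "'b set \<Rightarrow> 'b rel \<Rightarrow> 'b set \<Rightarrow> bool" where
  "is_interval X r J \<longleftrightarrow>
     J \<noteq> {} \<and> J \<subseteq> X \<and> (\<forall>x\<in>J. \<forall>z\<in>J. \<forall>y\<in>X. (x, y) \<in> r \<and> (y, z) \<in> r \<longrightarrow> y \<in> J)"

text \<open>
  \<open>I\<close> is a family indexed by the vertices, so distinct vertices may have the same interval.
\<close>

definition interval_representation ::
  "'b set \<Rightarrow> 'b rel \<Rightarrow> ('a \<Rightarrow> 'b set) \<Rightarrow> 'a pair_pre_digraph \<Rightarrow> bool" where
  "interval_representation X r I G \<longleftrightarrow>
     finite X \<and> linear_order_on X r \<and> (\<forall>v\<in>pverts G. is_interval X r (I v)) \<and>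
     (\<forall>u\<in>pverts G. \<forall>v\<in>pverts G. u \<noteq> v \<longrightarrow> ((u, v) \<in> parcs G \<longleftrightarrow> I u \<inter> I v \<noteq> {}))"

text \<open>
  Every finite totally ordered set has an isomorphic copy on a set of natural numbers, so
  taking the ground set \<open>X\<close> of type \<^typ>\<open>nat set\<close> is no restriction. The order \<open>r\<close> on it is arbitrary.
\<close>

definition interval_graph :: "'a pair_pre_digraph \<Rightarrow> bool" where
  "interval_graph G \<longleftrightarrow> (\<exists>(X :: nat set) r I. interval_representation X r I G)"

definition nested_on :: "'a set \<Rightarrow> ('a \<Rightarrow> 'b set) \<Rightarrow> bool" where
  "nested_on V I \<longleftrightarrow> (\<forall>u\<in>V. \<forall>v\<in>V. I u \<inter> I v = {} \<or> I u \<subseteq> I v \<or> I v \<subseteq> I u)"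

definition trivially_perfect_graph :: "'a pair_pre_digraph \<Rightarrow> bool" where
  "trivially_perfect_graph G \<longleftrightarrow>
     (\<exists>(X :: nat set) r I. interval_representation X r I G \<and> nested_on (pverts G) I)"

text \<open>A hole is given by the list of its vertices in cyclic order.\<close>

definition hole :: "'a pair_pre_digraph \<Rightarrow> 'a list \<Rightarrow> bool" where
  "hole G p \<longleftrightarrow> length p \<ge> 4 \<and> distinct p \<and> set p \<subseteq> pverts G \<and>
     (\<forall>i<length p. \<forall>j<length p.
        (p ! i, p ! j) \<in> parcs G \<longleftrightarrow> j = Suc i mod length p \<or> i = Suc j mod length p)"

definition hole_free :: "nat \<Rightarrow> 'a pair_pre_digraph \<Rightarrow> bool" where
  "hole_free k G \<longleftrightarrow> (\<forall>p. hole G p \<longrightarrow> length p \<le> k)"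

definition chordal_graph :: "'a pair_pre_digraph \<Rightarrow> bool" where
  "chordal_graph G \<longleftrightarrow> hole_free 3 G"

definition clique_number :: "'a pair_pre_digraph \<Rightarrow> nat" where
  "clique_number G = Max {card K | K. clique G K}"

definition proper_coloring :: "'a pair_pre_digraph \<Rightarrow> nat \<Rightarrow> ('a \<Rightarrow> nat) \<Rightarrow> bool" where
  "proper_coloring G n c \<longleftrightarrow>
     (\<forall>v\<in>pverts G. c v < n) \<and> (\<forall>(u, v)\<in>parcs G. c u \<noteq> c v)"

definition chromatic_number :: "'a pair_pre_digraph \<Rightarrow> nat" where
  "chromatic_number G = (LEAST n. \<exists>c. proper_coloring G n c)"

definition perfect_graph :: "'a pair_pre_digraph \<Rightarrow> bool" where
  "perfect_graph G \<longleftrightarrow>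
     (\<forall>H :: 'a pair_pre_digraph. induced_subgraph (with_proj H) (with_proj G) \<longrightarrow>
        clique_number H = chromatic_number H)"

end

theory Submission
  imports Defs
begin

text \<open>
  Assign to every element of \<open>utter G\<close> its support, a singleton or an edge of \<open>G\<close>. Two distinct
  elements are adjacent iff their supports touch, i.e. meet or are joined by an arc. Hence an
  interval representation (nested or not) extends to \<open>utter G\<close> by assigning to an edge the union of
  the intervals of its endpoints, and the edges can be added to the clique of a split partition.

  Suppose a hole of \<open>utter G\<close> contains an edge \<open>xy\<close>. Its two neighbours on the hole touch \<open>xy\<close>. If
  one of \<open>x\<close>, \<open>y\<close> touches both neighbours, it can replace \<open>xy\<close>; otherwise each of them touches
  exactly one neighbour, and \<open>xy\<close> can be replaced by the two vertices \<open>x\<close>, \<open>y\<close>. Repeating this gives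
  a hole of \<open>G\<close> that is at least as long. Its length may grow, though: the hexagon is bipartite and
  hence perfect, but contracting one of its edges gives a hole of length 5 in its utter graph.
\<close>

section \<open>Elements of the utter graph as touching vertex sets\<close>

definition support :: "'a + 'a set \<Rightarrow> 'a set" where
  "support a = (case a of Inl v \<Rightarrow> {v} | Inr e \<Rightarrow> e)"

definition touch :: "'a pair_pre_digraph \<Rightarrow> 'a set \<Rightarrow> 'a set \<Rightarrow> bool" where
  "touch G A B \<longleftrightarrow> (\<exists>x\<in>A. \<exists>y\<in>B. x = y \<or> (x, y) \<in> parcs G)"

lemma support_simps [simp]: "support (Inl v) = {v}" "support (Inr e) = e"
  by (simp_all add: support_def)

lemma touch_insert_left: "touch G (insert x A) B \<longleftrightarrow> touch G {x} B \<or> touch G A B"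
  by (auto simp: touch_def)

lemma touch_singletons [simp]: "touch G {x} {y} \<longleftrightarrow> x = y \<or> (x, y) \<in> parcs G"
  by (auto simp: touch_def)

lemma pverts_utter: "pverts (utter G) = pverts G <+> uedges G"
  by (simp add: utter_def Let_def)

lemma Inl_in_pverts_utter [simp]: "Inl v \<in> pverts (utter G) \<longleftrightarrow> v \<in> pverts G"
  by (auto simp: pverts_utter)

lemma Inr_in_pverts_utter [simp]: "Inr e \<in> pverts (utter G) \<longleftrightarrow> e \<in> uedges G"
  by (auto simp: pverts_utter)

context pair_graph
begin

text \<open>The case \<open>x = y\<close> stands for a vertex, the arc for an edge, so that later
  proofs treat both kinds of elements at once.\<close>

lemma support_utter:
  assumes "a \<in> pverts (utter G)"
  obtains x y where "support a = {x, y}" "x = y \<or> (x, y) \<in> parcs G" "x \<in> pverts G" "y \<in> pverts G"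
  using assms by (cases a) (auto simp: uedges_def dest: in_arcsD1 in_arcsD2)

lemma parcs_utter_iff:
  assumes "a \<in> pverts (utter G)" "b \<in> pverts (utter G)"
  shows "(a, b) \<in> parcs (utter G) \<longleftrightarrow> a \<noteq> b \<and> touch G (support a) (support b)"
proof -
  have "utter_adj G a b \<longleftrightarrow> a \<noteq> b \<and> touch G (support a) (support b)"
    \<comment> \<open>Loop-freeness supplies \<open>a \<noteq> b\<close> for two vertices. Symmetry
      turns around the arc in the edge-vertex clause, where it runs from the vertex to the
      edge.\<close>
    using no_loops' by (cases a; cases b) (auto simp: touch_def; metis arcs_symmetric)+
  with assms show ?thesis
    by (auto simp: utter_def Let_def)
qed

text \<open>Supports are nonempty and hence touch themselves, so passing to the reflexive closure
  absorbs the condition \<open>a \<noteq> b\<close>.\<close>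

lemma eq_or_parcs_utter_iff:
  assumes "a \<in> pverts (utter G)" "b \<in> pverts (utter G)"
  shows "a = b \<or> (a, b) \<in> parcs (utter G) \<longleftrightarrow> touch G (support a) (support b)"
proof -
  have "touch G (support a) (support a)"
    using assms(1) by (rule support_utter) (auto simp: touch_def)
  with assms show ?thesis
    by (auto simp: parcs_utter_iff)
qed

text \<open>Thus \<open>Inl\<close> embeds \<open>G\<close> as an induced subgraph, through which
  split partitions and interval representations restrict from \<open>utter G\<close> to
  \<open>G\<close>.\<close>

lemma parcs_utter_Inl_Inl:
  "(Inl v, Inl w) \<in> parcs (utter G) \<longleftrightarrow> (v, w) \<in> parcs G"
  by (auto simp: utter_def Let_def dest: in_arcsD1 in_arcsD2)

end


section \<open>Split graphs\<close>

text \<open>No edge has both ends in the stable set, so every edge has an end in the clique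
  \<open>K\<close>. Any two supports that meet \<open>K\<close> touch, hence \<open>K\<close>
  together with all edges is a clique of \<open>utter G\<close>.\<close>

lemma (in pair_graph) split_graph_utter_iff: "split_graph (utter G) \<longleftrightarrow> split_graph G"
proof
  assume "split_graph (utter G)"
  then obtain S K where SK: "S \<union> K = pverts (utter G)" "S \<inter> K = {}"
    "stable_set (utter G) S" "clique (utter G) K"
    by (auto simp: split_graph_def)
  have "Inl -` S \<union> Inl -` K = pverts G"
    using arg_cong[OF SK(1), of "\<lambda>A. Inl -` A"] by auto
  moreover have "Inl -` S \<inter> Inl -` K = {}"
    using SK(2) by auto
  ultimately show "split_graph G"
    using SK(3,4) unfolding split_graph_def stable_set_def clique_def
    by (intro exI[of _ "Inl -` S"] exI[of _ "Inl -` K"]) (auto simp flip: parcs_utter_Inl_Inl)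
next
  assume "split_graph G"
  then obtain S K where SK: "S \<union> K = pverts G" "S \<inter> K = {}" "stable_set G S" "clique G K"
    by (auto simp: split_graph_def)
  have edge: "\<exists>z\<in>support a. z \<in> K" if "a \<in> Inl ` K \<union> Inr ` uedges G" for a
  proof -
    have "x \<in> K \<or> y \<in> K" if "(x, y) \<in> parcs G" for x y
    proof -
      have "x \<in> S \<union> K" "y \<in> S \<union> K"
        using that SK(1) in_arcsD1 in_arcsD2 by auto
      with that SK(3) show ?thesis
        by (auto simp: stable_set_def)
    qed
    with that show ?thesis
      by (auto simp: uedges_def)
  qed
  have sub: "Inl ` K \<union> Inr ` uedges G \<subseteq> pverts (utter G)"
    using SK(1) by auto
  have "touch G (support a) (support b)"
    if "a \<in> Inl ` K \<union> Inr ` uedges G" "b \<in> Inl ` K \<union> Inr ` uedges G" for a b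
  proof -
    obtain z w where "z \<in> support a" "z \<in> K" "w \<in> support b" "w \<in> K"
      using \<open>a \<in> _\<close> \<open>b \<in> _\<close> edge by meson
    with SK(4) show ?thesis
      unfolding touch_def clique_def by blast
  qed
  then have "clique (utter G) (Inl ` K \<union> Inr ` uedges G)"
    unfolding clique_def using sub by (simp add: parcs_utter_iff subset_iff del: Un_iff)
  moreover have "stable_set (utter G) (Inl ` S)"
    using SK(1,3) by (auto simp: stable_set_def parcs_utter_Inl_Inl)
  ultimately show "split_graph (utter G)"
    using SK(1,2) unfolding split_graph_def
    by (intro exI[of _ "Inl ` S"] exI[of _ "Inl ` K \<union> Inr ` uedges G"]) (auto simp: pverts_utter)
qed


section \<open>Interval and trivially perfect graphs\<close>

text \<open>A common point \<open>w\<close> cuts the order in two. If \<open>x\<close>,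
  \<open>y\<close>, \<open>z\<close> are in increasing order, then \<open>y\<close> lies between
  \<open>x\<close> and \<open>w\<close> or between \<open>w\<close> and \<open>z\<close>; since
  \<open>w\<close> is in both intervals, \<open>y\<close> belongs to the one that contains
  \<open>x\<close> or \<open>z\<close>, respectively.\<close>

lemma is_interval_Un:
  assumes "linear_order_on X r" "is_interval X r I" "is_interval X r J" "I \<inter> J \<noteq> {}"
  shows "is_interval X r (I \<union> J)"
proof -
  obtain w where w: "w \<in> I" "w \<in> J" "w \<in> X"
    using assms(2,4) by (auto simp: is_interval_def)
  have tot: "(y, w) \<in> r \<or> (w, y) \<in> r" if "y \<in> X" for y
    using assms(1) that w(3)
    by (cases "y = w") (auto simp: order_on_defs total_on_def refl_on_def)
  have "y \<in> I \<union> J"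
    if "x \<in> I \<union> J" "z \<in> I \<union> J" "y \<in> X" "(x, y) \<in> r" "(y, z) \<in> r" for x y z
    using that tot[of y] w assms(2,3) unfolding is_interval_def by blast
  then show ?thesis
    using assms(2,3) unfolding is_interval_def by blast
qed

lemma (in pair_graph) interval_representation_utter:
  assumes "interval_representation X r I G"
  shows "interval_representation X r (\<lambda>a. \<Union>(I ` support a)) (utter G)"
proof -
  have lin: "linear_order_on X r" and int: "\<And>v. v \<in> pverts G \<Longrightarrow> is_interval X r (I v)"
    and arcs: "\<And>u v. u \<in> pverts G \<Longrightarrow> v \<in> pverts G \<Longrightarrow> u \<noteq> v \<Longrightarrow>
      (u, v) \<in> parcs G \<longleftrightarrow> I u \<inter> I v \<noteq> {}"
    using assms by (auto simp: interval_representation_def)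
  \<comment> \<open>Intervals are nonempty, so each meets itself, in agreement with the reflexive
    part of \<open>touch\<close>.\<close>
  have meet: "I u \<inter> I v \<noteq> {} \<longleftrightarrow> u = v \<or> (u, v) \<in> parcs G"
    if "u \<in> pverts G" "v \<in> pverts G" for u v
    using arcs[OF that] int[OF that(1)] by (cases "u = v") (auto simp: is_interval_def)
  have "is_interval X r (\<Union>(I ` support a))" if a: "a \<in> pverts (utter G)" for a
  proof -
    obtain x y where xy: "support a = {x, y}" "x = y \<or> (x, y) \<in> parcs G"
      "x \<in> pverts G" "y \<in> pverts G"
      using a by (rule support_utter)
    then have "is_interval X r (I x \<union> I y)"
      by (intro is_interval_Un lin int) (simp_all add: meet)
    with xy(1) show ?thesis
      by simp
  qed
  moreover have "(a, b) \<in> parcs (utter G) \<longleftrightarrow> \<Union>(I ` support a) \<inter> \<Union>(I ` support b) \<noteq> {}"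
    if ab: "a \<in> pverts (utter G)" "b \<in> pverts (utter G)" "a \<noteq> b" for a b
  proof -
    have "\<Union>(I ` support a) \<inter> \<Union>(I ` support b) \<noteq> {} \<longleftrightarrow>
        (\<exists>x\<in>support a. \<exists>y\<in>support b. I x \<inter> I y \<noteq> {})"
      by blast
    also have "\<dots> \<longleftrightarrow> touch G (support a) (support b)"
    proof -
      have "support a \<subseteq> pverts G" "support b \<subseteq> pverts G"
        using ab by (auto elim!: support_utter)
      then show ?thesis
        unfolding touch_def using meet by (meson subsetD)
    qed
    finally show ?thesis
      using ab by (simp add: parcs_utter_iff)
  qed
  ultimately show ?thesis
    using assms by (auto simp: interval_representation_def)
qed

lemma (in pair_graph) interval_representation_utter_Inl:
  assumes "interval_representation X r I (utter G)"
  shows "interval_representation X r (I \<circ> Inl) G"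
proof -
  have "(Inl u, Inl v) \<in> parcs (utter G) \<longleftrightarrow> I (Inl u) \<inter> I (Inl v) \<noteq> {}"
    if "u \<in> pverts G" "v \<in> pverts G" "u \<noteq> v" for u v
    using assms that by (simp add: interval_representation_def)
  moreover have "\<And>v. v \<in> pverts G \<Longrightarrow> is_interval X r (I (Inl v))"
    using assms by (simp add: interval_representation_def)
  ultimately show ?thesis
    using assms by (auto simp: interval_representation_def parcs_utter_Inl_Inl)
qed

lemma (in pair_graph) interval_graph_utter_iff: "interval_graph (utter G) \<longleftrightarrow> interval_graph G"
  unfolding interval_graph_def
  using interval_representation_utter interval_representation_utter_Inl by blast

text \<open>The intervals of the ends of an edge meet and are therefore comparable. Their union is
  the larger one, so no new intervals arise.\<close>

lemma (in pair_graph) nested_on_utter: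
  assumes "interval_representation X r I G" "nested_on (pverts G) I"
  shows "nested_on (pverts (utter G)) (\<lambda>a. \<Union>(I ` support a))"
proof -
  have "\<exists>x\<in>pverts G. \<Union>(I ` support a) = I x" if a: "a \<in> pverts (utter G)" for a
  proof -
    obtain x y where xy: "support a = {x, y}" "x = y \<or> (x, y) \<in> parcs G"
      "x \<in> pverts G" "y \<in> pverts G"
      using a by (rule support_utter)
    then have "x = y \<or> I x \<inter> I y \<noteq> {}"
      using assms(1) unfolding interval_representation_def by blast
    then have "I x \<subseteq> I y \<or> I y \<subseteq> I x"
      using xy(3,4) assms(2) unfolding nested_on_def by blast
    with xy show ?thesis
      by (auto simp: Un_absorb1 Un_absorb2)
  qed
  with assms(2) show ?thesis
    unfolding nested_on_def by metis
qed

lemma (in pair_graph) trivially_perfect_graph_utter_iff: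
  "trivially_perfect_graph (utter G) \<longleftrightarrow> trivially_perfect_graph G"
proof
  assume "trivially_perfect_graph (utter G)"
  then obtain X :: "nat set" and r I
    where "interval_representation X r I (utter G)" "nested_on (pverts (utter G)) I"
    by (auto simp: trivially_perfect_graph_def)
  moreover from this(2) have "nested_on (pverts G) (I \<circ> Inl)"
    by (simp add: nested_on_def)
  ultimately show "trivially_perfect_graph G"
    unfolding trivially_perfect_graph_def using interval_representation_utter_Inl by blast
next
  assume "trivially_perfect_graph G"
  then show "trivially_perfect_graph (utter G)"
    unfolding trivially_perfect_graph_def
    using interval_representation_utter nested_on_utter by blast
qed


section \<open>Holes\<close>

text \<open>
  The predicates look at pairs \<open>i < j\<close> only, so they can be used with the reflexive relation
  \<^const>\<open>touch\<close>.
\<close>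

definition induced_path :: "('b \<Rightarrow> 'b \<Rightarrow> bool) \<Rightarrow> 'b list \<Rightarrow> bool" where
  "induced_path R p \<longleftrightarrow> (\<forall>i j. i < j \<and> j < length p \<longrightarrow> (R (p ! i) (p ! j) \<longleftrightarrow> j = Suc i))"

definition induced_cycle :: "('b \<Rightarrow> 'b \<Rightarrow> bool) \<Rightarrow> 'b list \<Rightarrow> bool" where
  "induced_cycle R p \<longleftrightarrow> 4 \<le> length p \<and>
     (\<forall>i j. i < j \<and> j < length p \<longrightarrow>
        (R (p ! i) (p ! j) \<longleftrightarrow> j = Suc i \<or> i = 0 \<and> Suc j = length p))"

section \<open>Recursion and rotation for induced paths and cycles\<close>

lemma induced_path_Nil [simp]: "induced_path R []"
  by (simp add: induced_path_def)

lemma induced_path_Cons: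
  "induced_path R (a # q) \<longleftrightarrow> induced_path R q \<and> (\<forall>j<length q. R a (q ! j) \<longleftrightarrow> j = 0)"
  (is "?L \<longleftrightarrow> ?P \<and> ?Q")
proof
  assume L: ?L
  have "R ((a # q) ! Suc i) ((a # q) ! Suc j) \<longleftrightarrow> j = Suc i" if "i < j" "j < length q" for i j
    using L that unfolding induced_path_def by (metis Suc_less_eq length_Cons nat.inject)
  moreover have "R ((a # q) ! 0) ((a # q) ! Suc j) \<longleftrightarrow> j = 0" if "j < length q" for j
    using L that unfolding induced_path_def by (metis Suc_less_eq length_Cons nat.inject zero_less_Suc)
  ultimately show "?P \<and> ?Q"
    by (simp add: induced_path_def)
next
  assume "?P \<and> ?Q"
  then show ?L
    by (auto simp: induced_path_def nth_Cons split: nat.split)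
qed

text \<open>Removing a vertex from an induced cycle leaves an induced path whose two ends are the
  neighbours of that vertex. In this form the first entry can be exchanged while \<open>q\<close> is
  kept.\<close>

lemma induced_cycle_Cons:
  "induced_cycle R (a # q) \<longleftrightarrow> 3 \<le> length q \<and> induced_path R q \<and>
     (\<forall>j<length q. R a (q ! j) \<longleftrightarrow> j = 0 \<or> Suc j = length q)"
  (is "?L \<longleftrightarrow> ?N \<and> ?P \<and> ?Q")
proof
  assume L: ?L
  have "R ((a # q) ! Suc i) ((a # q) ! Suc j) \<longleftrightarrow> j = Suc i" if "i < j" "j < length q" for i j
    using L that unfolding induced_cycle_def
    by (metis Suc_less_eq length_Cons nat.inject nat.distinct(1))
  moreover have "R ((a # q) ! 0) ((a # q) ! Suc j) \<longleftrightarrow> j = 0 \<or> Suc j = length q"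
    if "j < length q" for j
    using L that unfolding induced_cycle_def
    by (metis Suc_less_eq length_Cons nat.inject zero_less_Suc)
  ultimately show "?N \<and> ?P \<and> ?Q"
    using L by (simp add: induced_path_def induced_cycle_def)
next
  assume "?N \<and> ?P \<and> ?Q"
  then show ?L
    by (auto simp: induced_path_def induced_cycle_def nth_Cons split: nat.split)
qed

text \<open>Rotating the cycle brings any chosen entry to the front. The cases are: both positions
  in \<open>q\<close>, one in each block, both in \<open>p\<close>.\<close>

lemma induced_cycle_append_commute:
  assumes "symp R" "induced_cycle R (p @ q)"
  shows "induced_cycle R (q @ p)"
proof -
  let ?m = "length p" and ?n = "length q"
  have R: "R ((p @ q) ! i) ((p @ q) ! j) \<longleftrightarrow> j = Suc i \<or> i = 0 \<and> Suc j = ?m + ?n"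
    if "i < j" "j < ?m + ?n" for i j
    using assms(2) that by (simp add: induced_cycle_def)
  have "R ((q @ p) ! i) ((q @ p) ! j) \<longleftrightarrow> j = Suc i \<or> i = 0 \<and> Suc j = ?n + ?m"
    if ij: "i < j" "j < ?n + ?m" for i j
  proof -
    consider "j < ?n" | "i < ?n" "?n \<le> j" | "?n \<le> i"
      by linarith
    then show ?thesis
    proof cases
      case 1
      with ij R[of "?m + i" "?m + j"] show ?thesis
        by (cases "p = []") (auto simp: nth_append simp flip: length_greater_0_conv)
    next
      case 2
      then obtain k where k: "j = ?n + k" "k < ?m"
        using ij(2) by (metis le_Suc_ex nat_add_left_cancel_less)
      \<comment> \<open>Rotation reverses the order of positions from different blocks, hence the
        appeal to symmetry.\<close>
      have "R (q ! i) (p ! k) \<longleftrightarrow> R (p ! k) (q ! i)"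
        using sympD[OF assms(1)] by blast
      also have "\<dots> \<longleftrightarrow> ?m + i = Suc k \<or> k = 0 \<and> Suc (?m + i) = ?m + ?n"
        using R[of k "?m + i"] 2 k(2) by (simp add: nth_append)
      also have "\<dots> \<longleftrightarrow> j = Suc i \<or> i = 0 \<and> Suc j = ?n + ?m"
        using 2 k by auto
      finally show ?thesis
        using 2 k by (simp add: nth_append)
    next
      case 3
      then obtain k l where k: "i = ?n + k" "j = ?n + l"
        using ij(1) by (metis le_Suc_ex less_imp_le order_trans)
      then have "R (p ! k) (p ! l) \<longleftrightarrow> l = Suc k \<or> k = 0 \<and> Suc l = ?m + ?n"
        using R[of k l] ij by (simp add: nth_append)
      \<comment> \<open>The last position of \<open>p @ q\<close> lies in \<open>p\<close> only if
        \<open>q\<close> is empty.\<close>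
      moreover have "Suc l = ?m + ?n \<longleftrightarrow> q = [] \<and> Suc l = ?m"
        using k(2) ij(2) by (cases q) auto
      ultimately show ?thesis
        using k by (auto simp: nth_append)
    qed
  qed
  with assms(2) show ?thesis
    by (simp add: induced_cycle_def)
qed

lemma induced_cycle_map:
  "induced_cycle R (map f p) \<longleftrightarrow> induced_cycle (\<lambda>x y. R (f x) (f y)) p"
  by (auto simp: induced_cycle_def)

lemma induced_cycle_cong:
  assumes "\<And>x y. x \<in> set p \<Longrightarrow> y \<in> set p \<Longrightarrow> R x y \<longleftrightarrow> R' x y"
  shows "induced_cycle R p \<longleftrightarrow> induced_cycle R' p"
proof -
  have "R (p ! i) (p ! j) \<longleftrightarrow> R' (p ! i) (p ! j)" if "i < j \<and> j < length p" for i j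
    using assms that by simp
  then show ?thesis
    by (simp add: induced_cycle_def cong: imp_cong)
qed

text \<open>Equal entries are related by reflexivity, hence cyclically consecutive. As there are at
  least four entries, some third entry is related to exactly one of the two positions, a
  contradiction.\<close>

lemma induced_cycle_distinct:
  assumes "symp R" "reflp R" "induced_cycle R p"
  shows "distinct p"
proof -
  let ?n = "length p"
  have n: "4 \<le> ?n" and R: "\<And>i j. i < j \<Longrightarrow> j < ?n \<Longrightarrow>
      R (p ! i) (p ! j) \<longleftrightarrow> j = Suc i \<or> i = 0 \<and> Suc j = ?n"
    using assms(3) by (auto simp: induced_cycle_def)
  have "p ! i \<noteq> p ! j" if ij: "i < j" "j < ?n" for i j
  proof
    assume eq: "p ! i = p ! j"
    then have "R (p ! i) (p ! j)"
      using assms(2) by (metis reflpD)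
    then consider "j = Suc i" "Suc j < ?n" | "j = Suc i" "Suc j = ?n" | "i = 0" "Suc j = ?n"
      using R ij by fastforce
    then show False
    proof cases
      case 1
      with n R[of j "Suc j"] R[of i "Suc j"] eq show False
        by auto
    next
      case 2
      with n R[of 0 i] R[of 0 j] eq show False
        by auto
    next
      case 3
      with n ij R[of 0 1] R[of 1 j] eq sympD[OF assms(1)] show False
        by auto
    qed
  qed
  then show ?thesis
    by (metis distinct_conv_nth nat_neq_iff)
qed

section \<open>Holes as induced cycles of touching sets\<close>

context pair_graph
begin

lemma symp_touch: "symp (touch G)"
  unfolding symp_def touch_def by (metis arcs_symmetric)

lemma hole_iff_induced_cycle:
  "hole G p \<longleftrightarrow> set p \<subseteq> pverts G \<and> induced_cycle (\<lambda>x y. x = y \<or> (x, y) \<in> parcs G) p"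
  (is "_ \<longleftrightarrow> _ \<and> induced_cycle ?R p")
proof -
  let ?n = "length p"
  let ?E = "\<lambda>i j. j = Suc i mod ?n \<or> i = Suc j mod ?n"
  \<comment> \<open>For \<open>i < j\<close> the successor of \<open>i\<close> does not wrap around;
    the successor of \<open>j\<close> equals \<open>i\<close> only if it wraps to 0.\<close>
  have E: "?E i j \<longleftrightarrow> j = Suc i \<or> i = 0 \<and> Suc j = ?n" if "4 \<le> ?n" "i < j" "j < ?n" for i j
    using that by (auto simp: mod_Suc)
  have E': "\<not> ?E i i" if "4 \<le> ?n" "i < ?n" for i
    using that by (auto simp: mod_Suc)
  have dist: "distinct p" if "induced_cycle ?R p"
    using that by (rule induced_cycle_distinct[rotated 2])
      (auto intro!: sympI reflpI intro: arcs_symmetric)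
  show ?thesis
  proof
    assume "hole G p"
    then have h: "4 \<le> ?n" "distinct p" "set p \<subseteq> pverts G"
      and adj: "\<And>i j. i < ?n \<Longrightarrow> j < ?n \<Longrightarrow> (p ! i, p ! j) \<in> parcs G \<longleftrightarrow> ?E i j"
      by (auto simp: hole_def)
    have "?R (p ! i) (p ! j) \<longleftrightarrow> j = Suc i \<or> i = 0 \<and> Suc j = ?n" if "i < j" "j < ?n" for i j
      using E[OF h(1) that] adj[of i j] that h(2) by (auto simp: nth_eq_iff_index_eq)
    with h show "set p \<subseteq> pverts G \<and> induced_cycle ?R p"
      by (simp add: induced_cycle_def)
  next
    assume R: "set p \<subseteq> pverts G \<and> induced_cycle ?R p"
    then have n: "4 \<le> ?n" and d: "distinct p"
      using dist by (auto simp: induced_cycle_def)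
    have lt: "(p ! i, p ! j) \<in> parcs G \<longleftrightarrow> ?E i j" if "i < j" "j < ?n" for i j
    proof -
      have "p ! i \<noteq> p ! j"
        using that d by (auto simp: nth_eq_iff_index_eq)
      moreover have "?R (p ! i) (p ! j) \<longleftrightarrow> j = Suc i \<or> i = 0 \<and> Suc j = ?n"
        using R that unfolding induced_cycle_def by blast
      ultimately show ?thesis
        using E[OF n that] by blast
    qed
    have "(p ! i, p ! j) \<in> parcs G \<longleftrightarrow> ?E i j" if "i < ?n" "j < ?n" for i j
    proof (cases i j rule: linorder_cases)
      case less
      with lt that show ?thesis by blast
    next
      case equal
      with E'[OF n that(1)] no_loops' show ?thesis by auto
    next
      case greater
      with lt[of j i] that arcs_symmetric show ?thesis by blast
    qed
    with R n d show "hole G p"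
      by (simp add: hole_def)
  qed
qed

text \<open>This moves from elements of \<open>utter G\<close> to vertex sets, so that edges and
  singletons can be exchanged within one list.\<close>

lemma hole_utter_iff_induced_cycle:
  "hole (utter G) p \<longleftrightarrow> set p \<subseteq> pverts (utter G) \<and> induced_cycle (touch G) (map support p)"
proof -
  interpret U: pair_graph "utter G"
    using pair_graph_utter pair_graph by blast
  show ?thesis
    unfolding U.hole_iff_induced_cycle induced_cycle_map
    by (intro conj_cong refl induced_cycle_cong eq_or_parcs_utter_iff) auto
qed

section \<open>Expanding the edges of a hole into vertices\<close>

lemma induced_cycle_touch_expand_edge:
  assumes "induced_cycle (touch G) ({x, y} # q)" "(x, y) \<in> parcs G"
  obtains (expansion) r where "set r \<subseteq> {{x}, {y}}" "r \<noteq> []" "induced_cycle (touch G) (r @ q)"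
proof -
  let ?n = "length q"
  have q: "3 \<le> ?n" "induced_path (touch G) q"
    and T: "\<And>j. j < ?n \<Longrightarrow> touch G {x} (q ! j) \<or> touch G {y} (q ! j) \<longleftrightarrow> j = 0 \<or> Suc j = ?n"
    using assms(1) by (auto simp: induced_cycle_Cons touch_insert_left[of G x "{y}"])
  \<comment> \<open>One endpoint touches both ends of the path \<open>q\<close>: it alone replaces
    the edge.\<close>
  have one: thesis
    if z: "z \<in> {x, y}" "touch G {z} (q ! 0)" "touch G {z} (q ! (?n - 1))" for z
  proof (rule expansion)
    have "touch G {z} (q ! j) \<longleftrightarrow> j = 0 \<or> Suc j = ?n" if "j < ?n" for j
    proof
      assume "j = 0 \<or> Suc j = ?n"
      then have "j = 0 \<or> j = ?n - 1"
        by auto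
      with z show "touch G {z} (q ! j)"
        by auto
    qed (use T[OF that] z in auto)
    with q show "induced_cycle (touch G) ([{z}] @ q)"
      by (simp add: induced_cycle_Cons)
    show "set [{z}] \<subseteq> {{x}, {y}}"
      using z by auto
  qed simp
  \<comment> \<open>Each endpoint touches a different end of \<open>q\<close>. The order is
    \<open>[{z}, {w}]\<close>, because \<open>w\<close> precedes the head of \<open>q\<close> and
    the cycle closes from the last entry of \<open>q\<close> back to \<open>z\<close>.\<close>
  have two: thesis
    if z: "{z, w} = {x, y}" "touch G {w} (q ! 0)" "\<not> touch G {w} (q ! (?n - 1))"
      "touch G {z} (q ! (?n - 1))" "\<not> touch G {z} (q ! 0)" for z w
  proof (rule expansion)
    have T': "touch G {z} (q ! j) \<or> touch G {w} (q ! j) \<longleftrightarrow> j = 0 \<or> j = ?n - 1" if "j < ?n" for j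
      using T[OF that] z(1) that by (auto simp: doubleton_eq_iff)
    have w: "touch G {w} (q ! j) \<longleftrightarrow> j = 0" if "j < ?n" for j
      using T'[OF that] z by auto
    have z': "touch G {z} (q ! j) \<longleftrightarrow> Suc j = ?n" if "j < ?n" for j
    proof -
      have "touch G {z} (q ! j) \<longleftrightarrow> j = ?n - 1"
        using T'[OF that] z by auto
      with that show ?thesis
        by auto
    qed
    have "(z, w) \<in> parcs G"
      using z(1) assms(2) arcs_symmetric by (auto simp: doubleton_eq_iff)
    then have "touch G {z} (({w} # q) ! j) \<longleftrightarrow> j = 0 \<or> Suc j = length ({w} # q)"
      if "j < length ({w} # q)" for j
      using that z' by (cases j) auto
    with q w show "induced_cycle (touch G) ([{z}, {w}] @ q)"
      by (simp add: induced_cycle_Cons induced_path_Cons)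
    show "set [{z}, {w}] \<subseteq> {{x}, {y}}"
      using z(1) by (auto simp: doubleton_eq_iff)
  qed simp
  have "touch G {x} (q ! 0) \<or> touch G {y} (q ! 0)"
    "touch G {x} (q ! (?n - 1)) \<or> touch G {y} (q ! (?n - 1))"
  proof -
    have "0 < ?n" "?n - 1 < ?n" "Suc (?n - 1) = ?n"
      using q(1) by auto
    with T[of 0] T[of "?n - 1"] show "touch G {x} (q ! 0) \<or> touch G {y} (q ! 0)"
      "touch G {x} (q ! (?n - 1)) \<or> touch G {y} (q ! (?n - 1))"
      by blast+
  qed
  with one[of x] one[of y] two[of x y] two[of y x] show thesis
    by auto
qed

text \<open>Induction on the number of entries that are not singletons. Rotate such an entry to the
  front and expand it: only singletons come in, so the number drops, and at least one comes in, so
  the list does not get shorter.\<close>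

lemma induced_cycle_touch_expand:
  assumes "induced_cycle (touch G) As"
    and "\<And>A. A \<in> set As \<Longrightarrow> \<exists>x y. A = {x, y} \<and> (x = y \<or> (x, y) \<in> parcs G)"
  obtains vs where "length As \<le> length vs" "set vs \<subseteq> \<Union>(set As)"
    "induced_cycle (touch G) (map (\<lambda>v. {v}) vs)"
  using assms
proof (induction "length (filter (\<lambda>A. \<nexists>v. A = {v}) As)" arbitrary: As thesis rule: less_induct)
  case less
  show ?case
  proof (cases "\<forall>A\<in>set As. \<exists>v. A = {v}")
    case True
    then have "map (\<lambda>A. {the_elem A}) As = As"
      by (intro map_idI) auto
    then have "map (\<lambda>v. {v}) (map the_elem As) = As"
      by (simp add: o_def)
    moreover from True have "set (map the_elem As) \<subseteq> \<Union>(set As)"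
      by fastforce
    ultimately show ?thesis
      using less.prems(1)[of "map the_elem As"] less.prems(2) by simp
  next
    case False
    then obtain A ps qs where A: "As = ps @ A # qs" "\<nexists>v. A = {v}"
      by (metis split_list)
    then obtain x y where xy: "A = {x, y}" "(x, y) \<in> parcs G"
      using less.prems(3)[of A] by auto
    let ?q = "qs @ ps"
    have "induced_cycle (touch G) ({x, y} # ?q)"
      using induced_cycle_append_commute[OF symp_touch, of ps "A # qs"] less.prems(2) A(1) xy(1)
      by simp
    then obtain r where r: "set r \<subseteq> {{x}, {y}}" "r \<noteq> []" "induced_cycle (touch G) (r @ ?q)"
      using xy(2) by (rule induced_cycle_touch_expand_edge)
    have "filter (\<lambda>A. \<nexists>v. A = {v}) r = []"
      using r(1) by (auto simp: filter_empty_conv)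
    then have "length (filter (\<lambda>A. \<nexists>v. A = {v}) (r @ ?q)) < length (filter (\<lambda>A. \<nexists>v. A = {v}) As)"
      using A by simp
    moreover have "\<exists>x y. B = {x, y} \<and> (x = y \<or> (x, y) \<in> parcs G)" if "B \<in> set (r @ ?q)" for B
      using that r(1) less.prems(3)[of B] A(1) by auto
    ultimately obtain vs where vs: "length (r @ ?q) \<le> length vs" "set vs \<subseteq> \<Union>(set (r @ ?q))"
      "induced_cycle (touch G) (map (\<lambda>v. {v}) vs)"
      using less.hyps[of "r @ ?q"] r(3) by blast
    have "length As \<le> length (r @ ?q)"
      using A(1) r(2) by (cases r) auto
    moreover have "\<Union>(set (r @ ?q)) \<subseteq> \<Union>(set As)"
      using r(1) A(1) xy(1) by auto
    ultimately show ?thesis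
      using vs less.prems(1)[of vs] by (meson order_trans)
  qed
qed

lemma hole_utter_imp_hole:
  assumes "hole (utter G) p"
  obtains q where "hole G q" "length p \<le> length q"
proof -
  have p: "set p \<subseteq> pverts (utter G)" "induced_cycle (touch G) (map support p)"
    using assms by (simp_all add: hole_utter_iff_induced_cycle)
  have sup: "\<exists>x y. A = {x, y} \<and> (x = y \<or> (x, y) \<in> parcs G) \<and> A \<subseteq> pverts G"
    if A: "A \<in> set (map support p)" for A
  proof -
    obtain a where "a \<in> pverts (utter G)" "A = support a"
      using A p(1) by auto
    then show ?thesis
      by (elim support_utter) auto
  qed
  then have "\<And>A. A \<in> set (map support p) \<Longrightarrow> \<exists>x y. A = {x, y} \<and> (x = y \<or> (x, y) \<in> parcs G)"
    by blast
  with p(2) obtain q where q: "length (map support p) \<le> length q" "set q \<subseteq> \<Union>(set (map support p))"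
    "induced_cycle (touch G) (map (\<lambda>v. {v}) q)"
    by (rule induced_cycle_touch_expand)
  moreover have "\<Union>(set (map support p)) \<subseteq> pverts G"
    using sup by blast
  ultimately show thesis
    using that[of q] by (simp add: hole_iff_induced_cycle induced_cycle_map)
qed

lemma hole_utter_map_Inl: "hole (utter G) (map Inl p) \<longleftrightarrow> hole G p"
  by (auto simp: hole_utter_iff_induced_cycle hole_iff_induced_cycle induced_cycle_map)

text \<open>Holes of \<open>G\<close> reappear in \<open>utter G\<close> with the same length, and
  each hole of \<open>utter G\<close> yields one of \<open>G\<close> at least as long. Hence every
  upper bound on hole lengths carries over both ways.\<close>

lemma hole_free_utter_iff: "hole_free k (utter G) \<longleftrightarrow> hole_free k G"
proof
  assume k: "hole_free k (utter G)"
  have "length p \<le> k" if "hole G p" for p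
    using k that unfolding hole_free_def by (metis hole_utter_map_Inl length_map)
  then show "hole_free k G"
    by (simp add: hole_free_def)
next
  assume "hole_free k G"
  then show "hole_free k (utter G)"
    unfolding hole_free_def by (meson hole_utter_imp_hole order_trans)
qed

end


section \<open>Perfect graphs\<close>

lemma clique_subset: "clique G K \<Longrightarrow> L \<subseteq> K \<Longrightarrow> clique G L"
  by (auto simp: clique_def)

text \<open>A proper colouring is injective on a clique.\<close>

lemma card_clique_le_colors:
  assumes "proper_coloring G n c" "clique G K"
  shows "card K \<le> n"
proof -
  have "inj_on c K"
    using assms by (fastforce simp: inj_on_def proper_coloring_def clique_def)
  moreover have "c ` K \<subseteq> {..<n}"
    using assms by (auto simp: proper_coloring_def clique_def)
  ultimately show ?thesis
    by (metis card_inj_on_le card_lessThan finite_lessThan)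
qed

lemma
  assumes "finite (pverts G)"
  shows card_clique_le_clique_number: "clique G K \<Longrightarrow> card K \<le> clique_number G"
    and clique_number_leI: "(\<And>K. clique G K \<Longrightarrow> card K \<le> n) \<Longrightarrow> clique_number G \<le> n"
proof -
  have "{card K | K. clique G K} \<subseteq> card ` Pow (pverts G)"
    by (auto simp: clique_def)
  then have fin: "finite {card K | K. clique G K}"
    using assms by (meson finite_Pow_iff finite_imageI finite_subset)
  show "clique G K \<Longrightarrow> card K \<le> clique_number G"
    unfolding clique_number_def using fin by (intro Max_ge) auto
  \<comment> \<open>The empty clique makes the set under \<open>Max\<close> nonempty.\<close>
  have "clique G {}"
    by (simp add: clique_def)
  then show "(\<And>K. clique G K \<Longrightarrow> card K \<le> n) \<Longrightarrow> clique_number G \<le> n"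
    unfolding clique_number_def using fin by (intro Max.boundedI) auto
qed

lemma chromatic_number_le: "proper_coloring G n c \<Longrightarrow> chromatic_number G \<le> n"
  unfolding chromatic_number_def by (rule Least_le) blast

text \<open>Some proper colouring must be known to exist for the \<open>LEAST\<close> to be
  attained.\<close>

lemma proper_coloring_chromatic_number:
  assumes "proper_coloring G n c"
  obtains c' where "proper_coloring G (chromatic_number G) c'"
  using LeastI[of "\<lambda>n. \<exists>c. proper_coloring G n c" n] assms
  unfolding chromatic_number_def by blast

lemma clique_number_le_chromatic_number:
  assumes "finite (pverts G)" "proper_coloring G n c"
  shows "clique_number G \<le> chromatic_number G"
  using assms by (metis clique_number_leI card_clique_le_colors proper_coloring_chromatic_number)

lemma induced_subgraph_parcs:
  assumes "induced_subgraph (with_proj H) (with_proj G)"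
  shows "pverts H \<subseteq> pverts G" "pair_wf_digraph H"
    "parcs H = {(u, v) \<in> parcs G. u \<in> pverts H \<and> v \<in> pverts H}"
  using assms by (auto simp: induced_subgraph_def subgraph_def wf_digraph_wp_iff)

text \<open>Induced subgraphs inherit the 2-colouring. With an arc both numbers are 2, without arcs
  but with a vertex they are 1, and for the empty graph they are 0.\<close>

lemma (in pair_graph) two_colorable_imp_perfect:
  assumes c: "proper_coloring G 2 c"
  shows "perfect_graph G"
  unfolding perfect_graph_def
proof (intro allI impI)
  fix H :: "'a pair_pre_digraph"
  assume "induced_subgraph (with_proj H) (with_proj G)"
  note H = induced_subgraph_parcs[OF this]
  have fin: "finite (pverts H)"
    using H(1) pair_finite_verts by (rule finite_subset)
  have cH: "proper_coloring H 2 c"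
    using c H by (auto simp: proper_coloring_def)
  have "chromatic_number H \<le> clique_number H"
  proof (cases "parcs H = {}")
    case False
    then obtain u v where uv: "(u, v) \<in> parcs H"
      by auto
    then have "u \<in> pverts H" "v \<in> pverts H" "u \<noteq> v" "(v, u) \<in> parcs H"
      using H(3) no_loops' arcs_symmetric by auto
    then have "clique H {u, v}" "card {u, v} = 2"
      using uv by (auto simp: clique_def)
    then show ?thesis
      using card_clique_le_clique_number[OF fin] chromatic_number_le[OF cH] by fastforce
  next
    case no_arcs: True
    show ?thesis
    proof (cases "pverts H = {}")
      case True
      then have "proper_coloring H 0 c"
        using no_arcs by (simp add: proper_coloring_def)
      then show ?thesis
        using chromatic_number_le by fastforce
    next
      case False
      then obtain v where "clique H {v}"
        by (auto simp: clique_def)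
      then have "1 \<le> clique_number H"
        using card_clique_le_clique_number[OF fin] by fastforce
      moreover have "proper_coloring H 1 (\<lambda>_. 0)"
        using no_arcs by (simp add: proper_coloring_def)
      ultimately show ?thesis
        using chromatic_number_le by fastforce
    qed
  qed
  moreover have "clique_number H \<le> chromatic_number H"
    using fin cH by (rule clique_number_le_chromatic_number)
  ultimately show "clique_number H = chromatic_number H"
    by simp
qed

text \<open>The hole induces a triangle-free subgraph \<open>H\<close>. Perfection would colour it
  with at most two colours, which alternate around the cycle and clash where an odd cycle
  closes.\<close>

lemma (in pair_graph) odd_hole_imp_not_perfect:
  assumes "hole G p" "odd (length p)"
  shows "\<not> perfect_graph G"
proof
  assume perf: "perfect_graph G"
  let ?n = "length p"
  define H where "H = \<lparr> pverts = set p, parcs = {(u, v) \<in> parcs G. u \<in> set p \<and> v \<in> set p} \<rparr>"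
  have n: "4 \<le> ?n" and p: "set p \<subseteq> pverts G"
    and adj: "\<And>i j. i < ?n \<Longrightarrow> j < ?n \<Longrightarrow>
      (p ! i, p ! j) \<in> parcs G \<longleftrightarrow> j = Suc i mod ?n \<or> i = Suc j mod ?n"
    using assms(1) by (auto simp: hole_def)
  have wf: "pair_wf_digraph H"
    by unfold_locales (auto simp: H_def)
  have "induced_subgraph (with_proj H) (with_proj G)"
    using p wf pair_wf_digraph
    by (auto simp: induced_subgraph_def subgraph_def compatible_def wf_digraph_wp_iff H_def)
  then have eq: "clique_number H = chromatic_number H"
    using perf by (simp add: perfect_graph_def)
  have "clique_number H \<le> 2"
  proof (rule clique_number_leI)
    show "finite (pverts H)"
      by (simp add: H_def)
    fix K assume K: "clique H K"
    show "card K \<le> 2"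
    proof (rule ccontr)
      assume "\<not> card K \<le> 2"
      then obtain L where "L \<subseteq> K" "card L = 3"
        using obtain_subset_with_card_n[of 3 K] by auto
      then obtain x y z where xyz: "clique H {x, y, z}" "x \<noteq> y" "y \<noteq> z" "x \<noteq> z"
        using K clique_subset by (metis card_3_iff)
      then have "x \<in> set p" "y \<in> set p" "z \<in> set p"
        by (auto simp: clique_def H_def)
      then obtain i j k where ijk: "i < ?n" "j < ?n" "k < ?n" "x = p ! i" "y = p ! j" "z = p ! k"
        by (metis in_set_conv_nth)
      have "(x, y) \<in> parcs G" "(y, z) \<in> parcs G" "(x, z) \<in> parcs G"
        using xyz by (auto simp: clique_def H_def)
      then have "j = Suc i mod ?n \<or> i = Suc j mod ?n" "k = Suc j mod ?n \<or> j = Suc k mod ?n"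
        "k = Suc i mod ?n \<or> i = Suc k mod ?n" "i \<noteq> j" "j \<noteq> k" "i \<noteq> k"
        using adj ijk xyz by auto
      \<comment> \<open>Three pairwise cyclically consecutive positions would force
        \<open>length p\<close> to be 3.\<close>
      then show False
        using n ijk(1-3) by (auto simp: mod_Suc split: if_splits)
    qed
  qed
  \<comment> \<open>An injective numbering of the vertices is a proper colouring, so the chromatic
    number of \<open>H\<close> is attained.\<close>
  obtain c where c: "proper_coloring H (chromatic_number H) c"
  proof -
    obtain f :: "'a \<Rightarrow> nat" and m where f: "f ` set p = {i. i < m}" "inj_on f (set p)"
      using finite_imp_inj_to_nat_seg[of "set p"] by auto
    have "proper_coloring H m f"
      unfolding proper_coloring_def
    proof (intro conjI ballI)
      show "f v < m" if "v \<in> pverts H" for v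
        using f(1) that by (auto simp: H_def)
      show "case e of (u, v) \<Rightarrow> f u \<noteq> f v" if "e \<in> parcs H" for e
        using inj_onD[OF f(2)] that no_loops' by (auto simp: H_def)
    qed
    then show thesis
      by (rule proper_coloring_chromatic_number) (rule that)
  qed
  have c2: "c (p ! i) < 2" if "i < ?n" for i
  proof -
    have "c (p ! i) < chromatic_number H"
      using c that by (auto simp: proper_coloring_def H_def)
    with eq \<open>clique_number H \<le> 2\<close> show ?thesis
      by simp
  qed
  have alt: "c (p ! i) \<noteq> c (p ! (Suc i mod ?n))" if "i < ?n" for i
  proof -
    have "Suc i mod ?n < ?n"
      using that by (intro mod_less_divisor) auto
    then have "(p ! i, p ! (Suc i mod ?n)) \<in> parcs H"
      using adj that by (auto simp: H_def)
    with c show ?thesis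
      by (auto simp: proper_coloring_def)
  qed
  have par: "c (p ! i) = c (p ! 0) \<longleftrightarrow> even i" if "i < ?n" for i
    using that
  proof (induction i)
    case (Suc i)
    then have "c (p ! i) \<noteq> c (p ! Suc i)"
      using alt[of i] by simp
    moreover have "0 < ?n"
      using n by linarith
    ultimately show ?case
      using Suc c2[of i] c2[of "Suc i"] c2[of 0] by auto
  qed simp
  \<comment> \<open>The last position is even, so its colour is that of position 0, to which it is
    adjacent.\<close>
  have "even (?n - 1)"
    using assms(2) by simp
  then have "c (p ! (?n - 1)) = c (p ! 0)"
    using par[of "?n - 1"] n by auto
  moreover have "Suc (?n - 1) mod ?n = 0"
    using n by (subst Suc_diff_1) auto
  moreover have "?n - 1 < ?n"
    using n by linarith
  ultimately show False
    using alt by metis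
qed

section \<open>The hexagon as counterexample for perfect graphs\<close>

definition hexagon :: "nat pair_pre_digraph" where
  "hexagon = \<lparr> pverts = {..<6},
     parcs = {(i, j). i < 6 \<and> j < 6 \<and> (j = Suc i mod 6 \<or> i = Suc j mod 6)} \<rparr>"

lemma pair_graph_hexagon: "pair_graph hexagon"
proof unfold_locales
  have "parcs hexagon \<subseteq> {..<6} \<times> {..<6}"
    by (auto simp: hexagon_def)
  then show "finite (parcs hexagon)"
    by (rule finite_subset) simp
  show "symmetric (with_proj hexagon)"
    by (auto simp: symmetric_def hexagon_def intro!: symI)
  show "fst e \<noteq> snd e" if "e \<in> parcs hexagon" for e
    using that by (auto simp: hexagon_def mod_Suc split: if_splits)
qed (auto simp: hexagon_def)

lemma connected_hexagon: "Digraph_Component.connected (with_proj hexagon)"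
proof -
  interpret pair_graph hexagon
    by (rule pair_graph_hexagon)
  have from_0: "0 \<rightarrow>\<^sup>*\<^bsub>with_proj hexagon\<^esub> i" if "i < 6" for i
    using that
  proof (induction i)
    case 0
    show ?case
      by (rule reachable_refl) (simp add: hexagon_def)
  next
    case (Suc i)
    then have "(i, Suc i) \<in> parcs hexagon"
      by (auto simp: hexagon_def)
    with Suc show ?case
      by (auto intro: reachable_adj_trans)
  qed
  have "u \<rightarrow>\<^sup>*\<^bsub>with_proj hexagon\<^esub> v" if "u < 6" "v < 6" for u v
    using from_0 that by (meson reachable_trans symmetric_reachable')
  moreover have "pverts hexagon = {..<6}"
    by (simp add: hexagon_def)
  ultimately show ?thesis
    \<comment> \<open>Connectedness is strong connectedness of the symmetric closure, so
      reachability has to be carried over to it.\<close>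
    unfolding connected_def strongly_connected_def
    by (auto simp: lessThan_empty_iff intro!: reachable_mk_symmetricI)
qed

lemma perfect_graph_hexagon: "perfect_graph hexagon"
proof (rule pair_graph.two_colorable_imp_perfect[OF pair_graph_hexagon])
  \<comment> \<open>As 6 is even, a step along the cycle changes parity even at the wrap-around;
    parity is thus a proper colouring.\<close>
  have "even (Suc i mod 6) \<longleftrightarrow> odd i" for i :: nat
    by presburger
  then show "proper_coloring hexagon 2 (\<lambda>i. i mod 2)"
    by (auto simp: proper_coloring_def hexagon_def mod_2_eq_odd)
qed

lemma not_perfect_graph_utter_hexagon: "\<not> perfect_graph (utter hexagon)"
proof (rule pair_graph.odd_hole_imp_not_perfect)
  show "pair_graph (utter hexagon)"
    by (rule pair_graph_utter[OF pair_graph_hexagon])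
  \<comment> \<open>The edge \<open>{0, 1}\<close> stands in for the vertices 0 and 1: it touches 2
    through 1 and 5 through 0. Six is the shortest even length for which this merging leaves an odd
    cycle long enough to be a hole.\<close>
  let ?p = "[Inr {0, 1}, Inl 2, Inl 3, Inl 4, Inl 5] :: (nat + nat set) list"
  have "induced_cycle (touch hexagon) (map support ?p)"
    by (simp add: induced_cycle_Cons induced_path_Cons All_less_Suc touch_def hexagon_def)
  moreover have "(0, 1) \<in> parcs hexagon"
    by (simp add: hexagon_def)
  then have "{0, 1} \<in> uedges hexagon"
    unfolding uedges_def by blast
  ultimately show "hole (utter hexagon) ?p"
    unfolding pair_graph.hole_utter_iff_induced_cycle[OF pair_graph_hexagon]
    by (simp add: hexagon_def)
qed simp

theorem corollary2p8:
  shows "stable_by_utter (split_graph :: 'a pair_pre_digraph \<Rightarrow> bool) split_graph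
    \<and> stable_by_utter (trivially_perfect_graph :: 'a pair_pre_digraph \<Rightarrow> bool) trivially_perfect_graph
    \<and> stable_by_utter (interval_graph :: 'a pair_pre_digraph \<Rightarrow> bool) interval_graph
    \<and> stable_by_utter (chordal_graph :: 'a pair_pre_digraph \<Rightarrow> bool) chordal_graph
    \<and> (\<forall>k\<ge>3. stable_by_utter (hole_free k :: 'a pair_pre_digraph \<Rightarrow> bool) (hole_free k))
    \<and> \<not> stable_by_utter (perfect_graph :: nat pair_pre_digraph \<Rightarrow> bool) perfect_graph"
proof -
  have "stable_by_utter (split_graph :: 'a pair_pre_digraph \<Rightarrow> bool) split_graph"
    "stable_by_utter (trivially_perfect_graph :: 'a pair_pre_digraph \<Rightarrow> bool) trivially_perfect_graph"
    "stable_by_utter (interval_graph :: 'a pair_pre_digraph \<Rightarrow> bool) interval_graph"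
    and hole_free: "stable_by_utter (hole_free k :: 'a pair_pre_digraph \<Rightarrow> bool) (hole_free k)" for k
    by (simp_all add: stable_by_utter_def pair_graph.split_graph_utter_iff
        pair_graph.trivially_perfect_graph_utter_iff pair_graph.interval_graph_utter_iff
        pair_graph.hole_free_utter_iff)
  moreover have "stable_by_utter (chordal_graph :: 'a pair_pre_digraph \<Rightarrow> bool) chordal_graph"
    using hole_free[of 3] by (simp add: stable_by_utter_def chordal_graph_def)
  moreover have "\<not> stable_by_utter (perfect_graph :: nat pair_pre_digraph \<Rightarrow> bool) perfect_graph"
    using pair_graph_hexagon connected_hexagon perfect_graph_hexagon
      not_perfect_graph_utter_hexagon
    by (auto simp: stable_by_utter_def)
  ultimately show ?thesis
    by blast
qed

end
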